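(* Let $X$ be a reflexive real Banach space, and let $\Phi,\Psi:X\to\mathbb{R}$ be two sequentially weakly lower semicontinuous and Gâteaux differentiable functionals. Assume also that $\Psi$ is (strongly) continuous and satisfies $\lim_{\|x\|\to+\infty}\Psi(x)=+\infty$. For each $\rho>\inf_X\Psi$, put $$\varphi(\rho)=\inf_{x\in\Psi^{-1}(]-\infty,\rho[)}\frac{\Phi(x)-\inf_{\overline{(\Psi^{-1}(]-\infty,\rho[))}_w}\Phi}{\rho-\Psi(x)},$$ where $\overline{(\Psi^{-1}(]-\infty,\rho[))}_w$ is the closure of $\Psi^{-1}(]-\infty,\rho[)$ in the weak topology. Furthermore, set $$\gamma=\liminf_{\rho\to+\infty}\varphi(\rho)\quad\text{and}\quad\delta=\liminf_{\rho\to(\inf_X\Psi)^+}\varphi(\rho).$$ Then the following conclusions hold: (a) For each $\rho>\inf_X\Psi$ and each $\lambda>\varphi(\rho)$, the functional $\Phi+\lambda\Psi$ has a critical point which lies in $\Psi^{-1}(]-\infty,\rho[)$. (b) If $\gamma<+\infty$, then, for each $\lambda>\gamma$, the following alternative holds: either $\Phi+\lambda\Psi$ has a global minimum, or the set of all critical points of $\Phi+\lambda\Psi$ is unbounded. (c) If $\delta<+\infty$, then, for each $\lambda>\delta$, the following alternative holds: either there exists a global minimum of $\Psi$ which is a local minimum of $\Phi+\lambda\Psi$, or there exists a sequence of pairwise distinct critical points of $\Phi+\lambda\Psi$ which weakly converges to a global minimum of $\Psi$.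
   Context: $]a,b[$ denotes the open interval with endpoints $a,b$. A critical point of a Gâteaux differentiable functional is a point at which its Gâteaux derivative is zero. A global minimum of a functional is a point at which it attains its infimum over $X$; local minima are with respect to the norm (strong) topology. *)

theory Defs
  imports "HOL-Analysis.Analysis"
begin

text \<open>The topological dual of a real normed space is the type \<open>'a \<Rightarrow>\<^sub>L real\<close>.
  The predicate takes a type as argument; it says that the canonical embedding into the
  bidual is onto.\<close>

definition reflexive_space :: "'a::real_normed_vector itself \<Rightarrow> bool" where
  "reflexive_space _ \<longleftrightarrow>
     (\<forall>F :: ('a \<Rightarrow>\<^sub>L real) \<Rightarrow>\<^sub>L real. \<exists>x::'a. \<forall>f. blinfun_apply F f = blinfun_apply f x)"

definition weak_topology :: "'a::real_normed_vector topology" where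
  "weak_topology =
     topology_generated_by {blinfun_apply f -` U |(f :: 'a \<Rightarrow>\<^sub>L real) U. open U}"

definition seq_weakly_lsc :: "('a::real_normed_vector \<Rightarrow> real) \<Rightarrow> bool" where
  "seq_weakly_lsc f \<longleftrightarrow>
     (\<forall>u x. limitin weak_topology u x sequentially \<longrightarrow>
        ereal (f x) \<le> liminf (\<lambda>n. ereal (f (u n))))"

definition has_gateaux_derivative ::
    "('a::real_normed_vector \<Rightarrow> real) \<Rightarrow> ('a \<Rightarrow>\<^sub>L real) \<Rightarrow> 'a \<Rightarrow> bool" where
  "has_gateaux_derivative f D x \<longleftrightarrow>
     (\<forall>h. ((\<lambda>t. (f (x + t *\<^sub>R h) - f x) / t) \<longlongrightarrow> blinfun_apply D h) (at 0))"

definition gateaux_differentiable :: "('a::real_normed_vector \<Rightarrow> real) \<Rightarrow> bool" where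
  "gateaux_differentiable f \<longleftrightarrow> (\<forall>x. \<exists>D. has_gateaux_derivative f D x)"

definition critical_point :: "('a::real_normed_vector \<Rightarrow> real) \<Rightarrow> 'a \<Rightarrow> bool" where
  "critical_point f x \<longleftrightarrow> has_gateaux_derivative f 0 x"

text \<open>Infima are taken in the extended reals, so that they are meaningful without a
  boundedness proof.\<close>

definition global_inf :: "('a \<Rightarrow> real) \<Rightarrow> ereal" where
  "global_inf f = (INF x. ereal (f x))"

definition global_minimum :: "('a \<Rightarrow> real) \<Rightarrow> 'a \<Rightarrow> bool" where
  "global_minimum f x \<longleftrightarrow> ereal (f x) = global_inf f"

definition local_minimum :: "('a::topological_space \<Rightarrow> real) \<Rightarrow> 'a \<Rightarrow> bool" where
  "local_minimum f x \<longleftrightarrow> (\<forall>\<^sub>F y in nhds x. f x \<le> f y)"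

definition phi ::
    "('a::real_normed_vector \<Rightarrow> real) \<Rightarrow> ('a \<Rightarrow> real) \<Rightarrow> real \<Rightarrow> ereal" where
  "phi \<Phi> \<Psi> \<rho> =
     (INF x \<in> \<Psi> -` {..<\<rho>}.
        (ereal (\<Phi> x) - (INF y \<in> weak_topology closure_of (\<Psi> -` {..<\<rho>}). ereal (\<Phi> y)))
          / ereal (\<rho> - \<Psi> x))"

definition gamma_inf :: "('a::real_normed_vector \<Rightarrow> real) \<Rightarrow> ('a \<Rightarrow> real) \<Rightarrow> ereal" where
  "gamma_inf \<Phi> \<Psi> = Liminf at_top (phi \<Phi> \<Psi>)"

text \<open>The filter below is the one of \<open>\<rho> \<rightarrow> m\<^sup>+\<close> on the reals with \<open>m = inf \<Psi>\<close>, pulled back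
  from the extended reals because \<open>m\<close> is an extended real; it is \<open>at_right m\<close> for real \<open>m\<close>.\<close>

definition delta_inf :: "('a::real_normed_vector \<Rightarrow> real) \<Rightarrow> ('a \<Rightarrow> real) \<Rightarrow> ereal" where
  "delta_inf \<Phi> \<Psi> = Liminf (filtercomap ereal (at_right (global_inf \<Psi>))) (phi \<Phi> \<Psi>)"

end

theory Submission
  imports Defs "HOL-Library.Diagonal_Subsequence"
begin

text \<open>The proof minimises \<open>\<Phi> + \<mu>\<Psi>\<close> over the weak closure \<open>C\<close> of a sublevel set \<open>S = {\<Psi> < \<rho>}\<close> and shows
that the minimiser cannot lie on the part of \<open>C\<close> outside \<open>S\<close>. By coercivity \<open>S\<close> is bounded, hence so
is \<open>C\<close>, and in a reflexive space a sequentially weakly lower semicontinuous function attains its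
minimum on a nonempty bounded weakly closed set (\<open>seq_weakly_lsc_attains_min\<close>). If
\<open>\<phi>(\<rho>) < \<mu>\<close>, some \<open>a \<in> S\<close> satisfies \<open>\<Phi> a + \<mu> \<Psi> a < min\<^sub>C \<Phi> + \<mu>\<rho>\<close>. A minimiser \<open>x\<close> of
\<open>\<Phi> + \<mu>\<Psi>\<close> over \<open>C\<close> does at least as well as \<open>a\<close>, and \<open>min\<^sub>C \<Phi> \<le> \<Phi> x\<close>, so \<open>\<Psi> x < \<rho>\<close>
(\<open>ex_sublevel_min\<close>). As \<open>S\<close> is open in norm, \<open>x\<close> is a critical point, which is (a).

For (b) and (c) take such minimisers \<open>u\<^sub>n\<close> along a sequence \<open>\<rho>\<^sub>n\<close> with \<open>\<phi>(\<rho>\<^sub>n) < \<mu>\<close>, tending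
to \<open>\<infinity>\<close> or to \<open>inf \<Psi>\<close>. If \<open>\<rho>\<^sub>n \<rightarrow> \<infinity>\<close> and the critical points are bounded, a weak limit of
a subsequence of \<open>u\<^sub>n\<close> minimises \<open>\<Phi> + \<mu>\<Psi>\<close> globally, because every point is eventually a
competitor of \<open>u\<^sub>n\<close>. If \<open>\<rho>\<^sub>n \<rightarrow> inf \<Psi>\<close>, weak limits of the \<open>u\<^sub>n\<close> are global minima of
\<open>\<Psi>\<close>. Either infinitely many of the \<open>u\<^sub>n\<close> are distinct, which gives the sequence of critical
points, or one value recurs infinitely often. That value is itself a global minimum of \<open>\<Psi>\<close>, and
it minimises \<open>\<Phi> + \<mu>\<Psi>\<close> on a norm neighbourhood of itself.

The functional analysis underneath is that bounded sequences in a reflexive space have weakly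
convergent subsequences (\<open>reflexive_bounded_imp_weakly_convergent_subseq\<close>). The functionals it needs all come from one form of
the Hahn-Banach theorem, \<open>hahn_banach_sublinear\<close>, applied to the norm, to the distance from a
closed subspace, and, on the dual space, to the upper limit of \<open>f (u n)\<close> as a function of \<open>f\<close>.\<close>

section \<open>The Hahn-Banach theorem\<close>

text \<open>Positive homogeneity is only required as an inequality, which is the part to be checked in the
applications. The reverse inequality follows by scaling back with \<open>1/c\<close>.\<close>

definition sublinear :: "('a::real_vector \<Rightarrow> real) \<Rightarrow> bool" where
  "sublinear p \<longleftrightarrow> (\<forall>x y. p (x + y) \<le> p x + p y) \<and> (\<forall>c x. 0 < c \<longrightarrow> p (c *\<^sub>R x) \<le> c * p x)"

lemma sublinear_add: "sublinear p \<Longrightarrow> p (x + y) \<le> p x + p y"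
  by (simp add: sublinear_def)

lemma sublinear_zero:
  assumes "sublinear p"
  shows "p 0 = 0"
proof -
  have "p (2 *\<^sub>R 0) \<le> 2 * p 0" "p ((1/2) *\<^sub>R 0) \<le> (1/2) * p 0"
    using assms by (auto simp only: sublinear_def)
  then show ?thesis by simp
qed

lemma sublinear_scale:
  assumes "sublinear p" "0 \<le> c"
  shows "p (c *\<^sub>R x) = c * p x"
proof (cases "c = 0")
  case False
  with assms have c: "0 < c" by simp
  have "p (c *\<^sub>R x) \<le> c * p x"
    using assms c by (simp add: sublinear_def)
  moreover have "p (inverse c *\<^sub>R (c *\<^sub>R x)) \<le> inverse c * p (c *\<^sub>R x)"
    using assms c unfolding sublinear_def by (metis inverse_positive_iff_positive)
  then have "c * p x \<le> p (c *\<^sub>R x)"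
    using c by (simp add: field_simps)
  ultimately show ?thesis by simp
qed (simp add: assms sublinear_zero)

lemma sublinear_neg_le: "sublinear p \<Longrightarrow> - p (- x) \<le> p x"
  using sublinear_add[of p x "- x"] sublinear_zero[of p] by simp

text \<open>This is the largest sublinear functional \<open>r \<le> p\<close> with \<open>r (- y) \<le> - p y\<close>: for such an \<open>r\<close> one has
\<open>r x \<le> r (x + t y) + t r (- y) \<le> p (x + t y) - t p y\<close>. A linear functional below it must
therefore agree with \<open>p\<close> at \<open>y\<close>.\<close>

definition tilt :: "('a::real_vector \<Rightarrow> real) \<Rightarrow> 'a \<Rightarrow> 'a \<Rightarrow> real" where
  "tilt p y x = (INF t\<in>{0..}. p (x + t *\<^sub>R y) - t * p y)"

lemma tilt_le:
  assumes "sublinear p" "0 \<le> t"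
  shows "tilt p y x \<le> p (x + t *\<^sub>R y) - t * p y"
  unfolding tilt_def
proof (rule cINF_lower)
  have "- p (- x) \<le> p (x + t *\<^sub>R y) - t * p y" if "0 \<le> t" for t
    using sublinear_add[of p "x + t *\<^sub>R y" "- x"] sublinear_scale[of p t y] assms that by simp
  then show "bdd_below ((\<lambda>t. p (x + t *\<^sub>R y) - t * p y) ` {0..})"
    by (auto intro!: bdd_belowI2)
qed (use assms in simp)

lemma tilt_greatest:
  assumes "\<And>t. 0 \<le> t \<Longrightarrow> b \<le> p (x + t *\<^sub>R y) - t * p y"
  shows "b \<le> tilt p y x"
  unfolding tilt_def by (rule cINF_greatest) (use assms in auto)

lemma sublinear_tilt:
  assumes p: "sublinear p"
  shows "sublinear (tilt p y)"
  unfolding sublinear_def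
proof (intro conjI allI impI)
  fix x z
  have "tilt p y (x + z) - (p (z + s *\<^sub>R y) - s * p y) \<le> p (x + t *\<^sub>R y) - t * p y"
    if "0 \<le> s" "0 \<le> t" for s t
    using tilt_le[OF p, of "t + s" y "x + z"] that
      sublinear_add[OF p, of "x + t *\<^sub>R y" "z + s *\<^sub>R y"]
    by (simp add: algebra_simps)
  then have "tilt p y (x + z) - (p (z + s *\<^sub>R y) - s * p y) \<le> tilt p y x" if "0 \<le> s" for s
    using that by (blast intro: tilt_greatest)
  then have "tilt p y (x + z) - tilt p y x \<le> p (z + s *\<^sub>R y) - s * p y" if "0 \<le> s" for s
    using that by (simp add: algebra_simps)
  then have "tilt p y (x + z) - tilt p y x \<le> tilt p y z"
    by (blast intro: tilt_greatest)
  then show "tilt p y (x + z) \<le> tilt p y x + tilt p y z" by simp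
next
  fix c :: real and x
  assume c: "0 < c"
  have "tilt p y (c *\<^sub>R x) / c \<le> p (x + t *\<^sub>R y) - t * p y" if "0 \<le> t" for t
  proof -
    have "tilt p y (c *\<^sub>R x) \<le> p (c *\<^sub>R (x + t *\<^sub>R y)) - (c * t) * p y"
      using tilt_le[OF p, of "c * t" y "c *\<^sub>R x"] that c by (simp add: algebra_simps)
    also have "p (c *\<^sub>R (x + t *\<^sub>R y)) = c * p (x + t *\<^sub>R y)"
      using c by (intro sublinear_scale[OF p]) simp
    finally show ?thesis
      using c by (simp add: field_simps)
  qed
  then have "tilt p y (c *\<^sub>R x) / c \<le> tilt p y x"
    by (blast intro: tilt_greatest)
  then show "tilt p y (c *\<^sub>R x) \<le> c * tilt p y x"
    using c by (simp add: field_simps)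
qed

text \<open>Tilting a minimal \<open>q\<close> in any direction \<open>y\<close> leaves it unchanged, and evaluating the tilt at \<open>t = 1\<close>
then gives \<open>q x + q y \<le> q (x + y)\<close>.\<close>

lemma minimal_sublinear_imp_linear:
  assumes q: "sublinear q" and min: "\<And>r. sublinear r \<Longrightarrow> r \<le> q \<Longrightarrow> r = q"
  shows "linear q"
proof -
  have add: "q (x + y) = q x + q y" for x y
  proof -
    have "tilt q y \<le> q"
      using tilt_le[OF q, of 0 y] by (auto simp: le_fun_def)
    then have "tilt q y = q"
      using min sublinear_tilt[OF q] by blast
    then have "q x \<le> q (x + y) - q y"
      using tilt_le[OF q, of 1 y x] by simp
    then show ?thesis
      using sublinear_add[OF q, of x y] by simp
  qed
  have neg: "q (- x) = - q x" for x
    using add[of x "- x"] sublinear_zero[OF q] by simp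
  have "q (c *\<^sub>R x) = c * q x" for c x
    using sublinear_scale[OF q, of c x] sublinear_scale[OF q, of "- c" x] neg[of "c *\<^sub>R x"]
    by (cases "0 \<le> c") auto
  with add show ?thesis
    by (simp add: linear_iff)
qed

text \<open>Zorn's lemma for the reversed pointwise order. A chain has its pointwise infimum as a lower bound;
the infimum is finite since every sublinear \<open>r \<le> p\<close> satisfies \<open>r x \<ge> - p (- x)\<close>, and it is
subadditive since two members of a chain may be replaced by the smaller one.\<close>

lemma ex_linear_le_sublinear:
  assumes p: "sublinear p"
  shows "\<exists>f. linear f \<and> f \<le> p"
proof -
  let ?A = "{q. sublinear q \<and> q \<le> p}"
  have "\<exists>m\<in>?A. \<forall>a\<in>?A. a \<le> m \<longrightarrow> a = m"
  proof (rule predicate_Zorn)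
    show "partial_order_on ?A (relation_of (\<lambda>x y. y \<le> x) ?A)"
      by (rule partial_order_on_relation_ofI) auto
  next
    fix C
    assume C: "C \<in> Chains (relation_of (\<lambda>x y. y \<le> x) ?A)"
    show "\<exists>u\<in>?A. \<forall>a\<in>C. u \<le> a"
    proof (cases "C = {}")
      case True
      with p show ?thesis by auto
    next
      case False
      have sub: "sublinear r" "r \<le> p" if "r \<in> C" for r
        using C that by (auto simp: Chains_def relation_of_def)
      have chain: "r \<le> s \<or> s \<le> r" if "r \<in> C" "s \<in> C" for r s
        using C that by (auto simp: Chains_def relation_of_def)
      define q where "q x = (INF r\<in>C. r x)" for x
      have "- p (- x) \<le> r x" if "r \<in> C" for r x
        using sublinear_neg_le[OF sub(1)[OF that], of x] le_funD[OF sub(2)[OF that], of "- x"]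
        by linarith
      then have "bdd_below ((\<lambda>r. r x) ` C)" for x
        by (auto intro!: bdd_belowI2)
      then have lower: "q x \<le> r x" if "r \<in> C" for r x
        unfolding q_def using that by (auto intro: cINF_lower)
      have greatest: "b \<le> q x" if "\<And>r. r \<in> C \<Longrightarrow> b \<le> r x" for b x
        unfolding q_def using False that by (auto intro: cINF_greatest)
      have "sublinear q"
        unfolding sublinear_def
      proof (intro conjI allI impI)
        fix x y
        have "q (x + y) - s y \<le> r x" if rs: "r \<in> C" "s \<in> C" for r s
        proof -
          obtain t where t: "t \<in> C" "t \<le> r" "t \<le> s"
            using chain[OF rs] rs by blast
          have "q (x + y) \<le> t x + t y"
            using lower[OF t(1), of "x + y"] sublinear_add[OF sub(1)[OF t(1)], of x y] by linarith
          also have "\<dots> \<le> r x + s y"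
            using t by (intro add_mono) (auto simp: le_fun_def)
          finally show ?thesis by simp
        qed
        then have *: "q (x + y) - s y \<le> q x" if "s \<in> C" for s
          using that by (blast intro: greatest)
        have "q (x + y) - q x \<le> s y" if "s \<in> C" for s
          using *[OF that] by linarith
        then have "q (x + y) - q x \<le> q y"
          by (blast intro: greatest)
        then show "q (x + y) \<le> q x + q y" by simp
      next
        fix c :: real and x
        assume c: "0 < c"
        have "q (c *\<^sub>R x) / c \<le> r x" if "r \<in> C" for r
          using lower[OF that, of "c *\<^sub>R x"] sublinear_scale[OF sub(1)[OF that], of c x] c
          by (simp add: field_simps)
        then have "q (c *\<^sub>R x) / c \<le> q x"
          by (blast intro: greatest)
        then show "q (c *\<^sub>R x) \<le> c * q x"
          using c by (simp add: field_simps)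
      qed
      moreover have "q \<le> p"
      proof -
        obtain r where "r \<in> C" using False by blast
        then have "q \<le> r" "r \<le> p" using lower sub by (auto simp: le_fun_def)
        then show ?thesis by simp
      qed
      ultimately show ?thesis
        using lower by (auto simp: le_fun_def)
    qed
  qed
  then obtain m where m: "sublinear m" "m \<le> p"
    and min: "\<And>a. sublinear a \<Longrightarrow> a \<le> p \<Longrightarrow> a \<le> m \<Longrightarrow> a = m"
    by blast
  have "linear m"
    using m min by (intro minimal_sublinear_imp_linear) (auto dest: order.trans)
  with m show ?thesis by blast
qed

theorem hahn_banach_sublinear:
  assumes p: "sublinear p"
  shows "\<exists>f. linear f \<and> (\<forall>x. f x \<le> p x) \<and> f y = p y"
proof -
  obtain f where f: "linear f" "f \<le> tilt p y"
    using ex_linear_le_sublinear[OF sublinear_tilt[OF p]] by blast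
  have le: "f x \<le> p x" for x
    using le_funD[OF f(2), of x] tilt_le[OF p, of 0 y x] by simp
  have "f (- y) \<le> - p y"
    using le_funD[OF f(2), of "- y"] tilt_le[OF p, of 1 y "- y"] sublinear_zero[OF p] by simp
  then have "p y \<le> f y"
    using linear_neg[OF f(1), of y] by simp
  with f le show ?thesis by (metis order_antisym)
qed

lemma ex_blinfun_le_sublinear:
  fixes p :: "'a::real_normed_vector \<Rightarrow> real"
  assumes p: "sublinear p" and bound: "\<And>x. p x \<le> B * norm x"
  shows "\<exists>f :: 'a \<Rightarrow>\<^sub>L real. (\<forall>x. blinfun_apply f x \<le> p x) \<and> blinfun_apply f y = p y"
proof -
  obtain f where f: "linear f" "\<And>x. f x \<le> p x" "f y = p y"
    using hahn_banach_sublinear[OF p] by blast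
  have "\<bar>f x\<bar> \<le> B * norm x" for x
    using f(2)[of x] f(2)[of "- x"] bound[of x] bound[of "- x"] linear_neg[OF f(1), of x] by auto
  then have "bounded_linear f"
    using f(1) by (intro bounded_linear_intro[of f B]) (auto simp: linear_add linear_scale mult.commute)
  then have "blinfun_apply (Blinfun f) = f"
    by (rule bounded_linear_Blinfun_apply)
  with f show ?thesis by metis
qed

lemma ex_norming_functional:
  fixes y :: "'a::real_normed_vector"
  shows "\<exists>f :: 'a \<Rightarrow>\<^sub>L real. (\<forall>x. blinfun_apply f x \<le> norm x) \<and> blinfun_apply f y = norm y"
  by (rule ex_blinfun_le_sublinear[of _ 1]) (auto simp: sublinear_def norm_triangle_ineq)

lemma sublinear_infdist:
  fixes Y :: "'a::real_normed_vector set"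
  assumes Y: "subspace Y"
  shows "sublinear (\<lambda>x. infdist x Y)"
  unfolding sublinear_def
proof (intro conjI allI impI)
  have ne: "Y \<noteq> {}" using subspace_0[OF Y] by auto
  have greatest: "b \<le> infdist x Y" if "\<And>a. a \<in> Y \<Longrightarrow> b \<le> dist x a" for b x
    using ne that by (auto simp: infdist_notempty intro: cINF_greatest)
  fix x y
  have "infdist (x + y) Y - dist y b \<le> dist x a" if "a \<in> Y" "b \<in> Y" for a b
    using infdist_le[OF subspace_add[OF Y that], of "x + y"] norm_triangle_ineq[of "x - a" "y - b"]
    by (simp add: dist_norm algebra_simps)
  then have "infdist (x + y) Y - dist y b \<le> infdist x Y" if "b \<in> Y" for b
    using that by (blast intro: greatest)
  then have "infdist (x + y) Y - infdist x Y \<le> dist y b" if "b \<in> Y" for b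
    using that by (simp add: algebra_simps)
  then have "infdist (x + y) Y - infdist x Y \<le> infdist y Y"
    by (blast intro: greatest)
  then show "infdist (x + y) Y \<le> infdist x Y + infdist y Y" by simp
  fix c :: real
  assume c: "0 < c"
  have "infdist (c *\<^sub>R x) Y / c \<le> dist x a" if "a \<in> Y" for a
  proof -
    have "infdist (c *\<^sub>R x) Y \<le> dist (c *\<^sub>R x) (c *\<^sub>R a)"
      by (rule infdist_le[OF subspace_scale[OF Y that]])
    also have "\<dots> = c * dist x a"
      using c by (simp add: dist_norm flip: scaleR_diff_right)
    finally show ?thesis
      using c by (simp add: pos_divide_le_eq mult.commute)
  qed
  then have "infdist (c *\<^sub>R x) Y / c \<le> infdist x Y"
    by (blast intro: greatest)
  then show "infdist (c *\<^sub>R x) Y \<le> c * infdist x Y"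
    using c by (simp add: pos_divide_le_eq mult.commute)
qed

text \<open>The distance from a subspace is a sublinear functional below the norm that vanishes on \<open>Y\<close> but not
at \<open>y\<close>; a functional below it vanishes on \<open>Y\<close> because \<open>Y = - Y\<close>.\<close>

lemma ex_annihilating_functional:
  fixes Y :: "'a::real_normed_vector set"
  assumes Y: "subspace Y" "closed Y" and y: "y \<notin> Y"
  shows "\<exists>f :: 'a \<Rightarrow>\<^sub>L real. (\<forall>x\<in>Y. blinfun_apply f x = 0) \<and> blinfun_apply f y \<noteq> 0"
proof -
  have ne: "Y \<noteq> {}" using subspace_0[OF Y(1)] by auto
  have "infdist x Y \<le> 1 * norm x" for x
    using infdist_le[OF subspace_0[OF Y(1)], of x] by simp
  then obtain f :: "'a \<Rightarrow>\<^sub>L real"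
    where f: "\<And>x. blinfun_apply f x \<le> infdist x Y" "blinfun_apply f y = infdist y Y"
    using ex_blinfun_le_sublinear[OF sublinear_infdist[OF Y(1)]] by blast
  have "blinfun_apply f x = 0" if "x \<in> Y" for x
    using f(1)[of x] f(1)[of "- x"] that subspace_neg[OF Y(1) that] by (simp add: blinfun.minus_right)
  moreover have "infdist y Y \<noteq> 0"
    using y ne Y(2) by (simp add: in_closed_iff_infdist_zero)
  ultimately show ?thesis using f(2) by metis
qed

section \<open>The weak topology\<close>

lemma topspace_weak_topology [simp]: "topspace (weak_topology :: 'a::real_normed_vector topology) = UNIV"
proof -
  have "UNIV \<in> {blinfun_apply f -` U |(f :: 'a \<Rightarrow>\<^sub>L real) U. open U}"
    by (auto intro!: exI[of _ 0] exI[of _ UNIV])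
  then show ?thesis
    unfolding weak_topology_def topology_generated_by_topspace by blast
qed

lemma openin_weak_vimage:
  fixes f :: "'a::real_normed_vector \<Rightarrow>\<^sub>L real"
  shows "open U \<Longrightarrow> openin weak_topology (blinfun_apply f -` U)"
  unfolding weak_topology_def by (rule topology_generated_by_Basis) blast

lemma limitin_weak_topology_iff:
  fixes x :: "'a::real_normed_vector"
  shows "limitin weak_topology u x F \<longleftrightarrow>
    (\<forall>f :: 'a \<Rightarrow>\<^sub>L real. ((\<lambda>n. blinfun_apply f (u n)) \<longlongrightarrow> blinfun_apply f x) F)"
proof (intro iffI allI)
  fix f :: "'a \<Rightarrow>\<^sub>L real"
  assume lim: "limitin weak_topology u x F"
  show "((\<lambda>n. blinfun_apply f (u n)) \<longlongrightarrow> blinfun_apply f x) F"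
  proof (rule topological_tendstoI)
    fix U :: "real set"
    assume "open U" "blinfun_apply f x \<in> U"
    then show "\<forall>\<^sub>F n in F. blinfun_apply f (u n) \<in> U"
      using lim openin_weak_vimage[of U f] by (auto simp: limitin_def)
  qed
next
  assume conv: "\<forall>f :: 'a \<Rightarrow>\<^sub>L real. ((\<lambda>n. blinfun_apply f (u n)) \<longlongrightarrow> blinfun_apply f x) F"
  have "x \<in> U \<longrightarrow> (\<forall>\<^sub>F n in F. u n \<in> U)" if "openin weak_topology U" for U
    using openin_topology_generated_by[OF that[unfolded weak_topology_def]]
  proof (induction rule: generate_topology_on.induct)
    case (Int a b)
    then show ?case by (auto intro: eventually_conj)
  next
    case (UN K)
    then show ?case by (blast intro: eventually_mono)
  next
    case (Basis s)
    then obtain f :: "'a \<Rightarrow>\<^sub>L real" and V where "s = blinfun_apply f -` V" "open V"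
      by blast
    then show ?case
      using conv by (auto dest: topological_tendstoD)
  qed simp
  then show "limitin weak_topology u x F"
    by (simp add: limitin_def)
qed

text \<open>The norm is the supremum of the functionals below it, so the ball is an intersection of weakly
closed half-spaces.\<close>

lemma closedin_weak_cball: "closedin weak_topology (cball (0 :: 'a::real_normed_vector) r)"
proof -
  let ?N = "{f :: 'a \<Rightarrow>\<^sub>L real. \<forall>x. blinfun_apply f x \<le> norm x}"
  have eq: "cball 0 r = (\<Inter>f\<in>?N. {x. blinfun_apply f x \<le> r})"
  proof (intro set_eqI iffI)
    fix x
    assume x: "x \<in> (\<Inter>f\<in>?N. {x. blinfun_apply f x \<le> r})"
    \<comment> \<open>a point outside the ball is excluded by its own norming functional\<close>
    obtain f :: "'a \<Rightarrow>\<^sub>L real" where f: "f \<in> ?N" "blinfun_apply f x = norm x"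
      using ex_norming_functional[of x] by blast
    then have "blinfun_apply f x \<le> r" using x by blast
    with f show "x \<in> cball 0 r" by simp
  qed (auto intro: order.trans)
  have "closedin weak_topology {x. blinfun_apply f x \<le> r}" for f :: "'a \<Rightarrow>\<^sub>L real"
  proof -
    have "UNIV - {x. blinfun_apply f x \<le> r} = blinfun_apply f -` {r<..}"
      by auto
    then show ?thesis
      using openin_weak_vimage[of "{r<..}" f] by (simp add: closedin_def)
  qed
  moreover have "?N \<noteq> {}"
    using ex_norming_functional[of "0::'a"] by blast
  ultimately show ?thesis
    unfolding eq by (intro closedin_Inter) auto
qed

lemma bounded_weak_closure:
  fixes S :: "'a::real_normed_vector set"
  assumes "bounded S"
  shows "bounded (weak_topology closure_of S)"
proof -
  obtain r where "\<forall>x\<in>S. norm x \<le> r"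
    using assms by (auto simp: bounded_iff)
  then have "S \<subseteq> cball 0 r" by auto
  then have "weak_topology closure_of S \<subseteq> cball 0 r"
    by (rule closure_of_minimal) (rule closedin_weak_cball)
  then show ?thesis by (rule bounded_subset[OF bounded_cball])
qed

section \<open>Weak sequential compactness in reflexive spaces\<close>

text \<open>The functional \<open>p f = limsup f (u n)\<close> on the dual space is sublinear and bounded by a multiple of the
norm. By Hahn-Banach there is a continuous linear functional below \<open>p\<close>, and by reflexivity
it is evaluation at some \<open>x\<close>. This \<open>x\<close> plays the part of a weak cluster point of \<open>u\<close>.\<close>

lemma reflexive_limit_point:
  fixes u :: "nat \<Rightarrow> 'a::real_normed_vector"
  assumes refl: "reflexive_space TYPE('a)" and bdd: "bounded (range u)"
  obtains x where
    "\<And>(f :: 'a \<Rightarrow>\<^sub>L real) l. (\<lambda>n. blinfun_apply f (u n)) \<longlonglongrightarrow> l \<Longrightarrow> blinfun_apply f x = l"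
proof -
  obtain M where M: "\<And>n. norm (u n) \<le> M"
    using bdd by (auto simp: bounded_iff)
  define A where "A f = {c. \<forall>\<^sub>F n in sequentially. blinfun_apply f (u n) \<le> c}" for f :: "'a \<Rightarrow>\<^sub>L real"
  \<comment> \<open>the limit superior, as the infimum of the eventual upper bounds\<close>
  define p where "p f = Inf (A f)" for f :: "'a \<Rightarrow>\<^sub>L real"
  have bound: "\<bar>blinfun_apply f (u n)\<bar> \<le> M * norm f" for f :: "'a \<Rightarrow>\<^sub>L real" and n
    using norm_blinfun[of f "u n"] mult_left_mono[OF M[of n], of "norm f"]
    by (simp add: mult.commute)
  have mem: "M * norm f \<in> A f" for f
    using bound[of f] by (auto simp: A_def abs_le_iff)
  have below: "- (M * norm f) \<le> c" if "c \<in> A f" for c f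
  proof -
    have "\<forall>\<^sub>F n in sequentially. - (M * norm f) \<le> c"
      using that unfolding A_def mem_Collect_eq
      by (rule eventually_mono) (use bound[of f] in \<open>smt (verit)\<close>)
    then show ?thesis by simp
  qed
  have lower: "p f \<le> c" if "c \<in> A f" for c f
    unfolding p_def using that below by (intro cInf_lower) (auto intro!: bdd_belowI)
  have greatest: "b \<le> p f" if "\<And>c. c \<in> A f \<Longrightarrow> b \<le> c" for b f
    unfolding p_def using that mem by (intro cInf_greatest) auto
  have "sublinear p"
    unfolding sublinear_def
  proof (intro conjI allI impI)
    fix f g
    have "c + d \<in> A (f + g)" if "c \<in> A f" "d \<in> A g" for c d
      using that unfolding A_def mem_Collect_eq
      by (rule eventually_elim2) (simp add: blinfun.add_left)
    then have "p (f + g) - d \<le> c" if "c \<in> A f" "d \<in> A g" for c d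
      using lower that by (simp add: diff_le_eq)
    then have *: "p (f + g) - d \<le> p f" if "d \<in> A g" for d
      using that by (blast intro: greatest)
    have "p (f + g) - p f \<le> d" if "d \<in> A g" for d
      using *[OF that] by linarith
    then have "p (f + g) - p f \<le> p g"
      by (blast intro: greatest)
    then show "p (f + g) \<le> p f + p g" by simp
  next
    fix t :: real and f
    assume t: "0 < t"
    have "p (t *\<^sub>R f) / t \<le> c" if "c \<in> A f" for c
    proof -
      have "t * c \<in> A (t *\<^sub>R f)"
        using that t by (auto simp: A_def blinfun.scaleR_left elim: eventually_mono)
      then show ?thesis
        using lower t by (simp add: pos_divide_le_eq mult.commute)
    qed
    then have "p (t *\<^sub>R f) / t \<le> p f"
      by (blast intro: greatest)
    then show "p (t *\<^sub>R f) \<le> t * p f"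
      using t by (simp add: pos_divide_le_eq mult.commute)
  qed
  then obtain F :: "('a \<Rightarrow>\<^sub>L real) \<Rightarrow>\<^sub>L real" where F: "\<And>f. blinfun_apply F f \<le> p f"
    using ex_blinfun_le_sublinear[of p M] lower[OF mem] by blast
  obtain x where x: "\<And>f. blinfun_apply F f = blinfun_apply f x"
    using refl unfolding reflexive_space_def by blast
  have le: "blinfun_apply f x \<le> l" if "(\<lambda>n. blinfun_apply f (u n)) \<longlonglongrightarrow> l" for f :: "'a \<Rightarrow>\<^sub>L real" and l
  proof (rule field_le_epsilon)
    fix e :: real
    assume "0 < e"
    then have "\<forall>\<^sub>F n in sequentially. blinfun_apply f (u n) < l + e"
      using that by (intro order_tendstoD) auto
    then have "l + e \<in> A f"
      by (auto simp: A_def elim: eventually_mono)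
    then show "blinfun_apply f x \<le> l + e"
      using lower F[of f] x[of f] by fastforce
  qed
  show thesis
  proof (rule that)
    fix f :: "'a \<Rightarrow>\<^sub>L real" and l
    assume lim: "(\<lambda>n. blinfun_apply f (u n)) \<longlonglongrightarrow> l"
    then have "(\<lambda>n. blinfun_apply (- f) (u n)) \<longlonglongrightarrow> - l"
      by (simp add: blinfun.minus_left tendsto_minus)
    then show "blinfun_apply f x = l"
      using le[OF lim] le[of "- f" "- l"] by (simp add: blinfun.minus_left)
  qed
qed

text \<open>The points \<open>D k\<close> enumerate the finite rational linear combinations of the \<open>u i\<close>, so the closure is
the closed linear span of \<open>u\<close>.\<close>

lemma countable_dense_closed_subspace:
  fixes u :: "nat \<Rightarrow> 'a::real_normed_vector"
  obtains D :: "nat \<Rightarrow> 'a"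
  where "subspace (closure (range D))" "range u \<subseteq> closure (range D)"
proof -
  define comb :: "(rat \<times> nat) list \<Rightarrow> 'a"
    where "comb l = (\<Sum>(q, i)\<leftarrow>l. of_rat q *\<^sub>R u i)" for l
  let ?R = "range comb"
  have add: "x + y \<in> ?R" if "x \<in> ?R" "y \<in> ?R" for x y
  proof -
    from that obtain k l where "x = comb k" "y = comb l" by blast
    then have "x + y = comb (k @ l)" by (simp add: comb_def)
    then show ?thesis by blast
  qed
  have "of_rat r *\<^sub>R comb l = comb (map (\<lambda>(q, i). (r * q, i)) l)" for r l
    by (induction l) (auto simp: comb_def scaleR_right_distrib of_rat_mult)
  then have scale: "of_rat r *\<^sub>R x \<in> ?R" if "x \<in> ?R" for r x
    using that by blast
  have sub: "subspace (closure ?R)"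
  proof (rule subspaceI)
    have "comb [] = 0" by (simp add: comb_def)
    then show "0 \<in> closure ?R"
      using closure_subset[of ?R] by (metis rangeI subsetD)
  next
    fix x y
    assume "x \<in> closure ?R" "y \<in> closure ?R"
    then obtain a b where "\<And>n. a n \<in> ?R" "a \<longlonglongrightarrow> x" "\<And>n. b n \<in> ?R" "b \<longlonglongrightarrow> y"
      unfolding closure_sequential by metis
    then show "x + y \<in> closure ?R"
      unfolding closure_sequential
      by (intro exI[of _ "\<lambda>n. a n + b n"]) (auto intro: add tendsto_add)
  next
    fix c :: real and x
    assume "x \<in> closure ?R"
    then obtain a where a: "\<And>n. a n \<in> ?R" "a \<longlonglongrightarrow> x"
      unfolding closure_sequential by metis
    have "c \<in> closure \<rat>"
      unfolding closure_approachable
    proof (intro allI impI)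
      fix e :: real
      assume "0 < e"
      then obtain q where "q \<in> \<rat>" "c < q" "q < c + e"
        using Rats_dense_in_real[of c "c + e"] by auto
      then show "\<exists>q\<in>\<rat>. dist q c < e"
        by (intro bexI[of _ q]) (auto simp: dist_real_def)
    qed
    then obtain q where q: "\<And>n. q n \<in> \<rat>" "q \<longlonglongrightarrow> c"
      unfolding closure_sequential by metis
    have "q n *\<^sub>R a n \<in> ?R" for n
      using q(1)[of n] scale[OF a(1)[of n]] by (auto elim: Rats_cases)
    then show "c *\<^sub>R x \<in> closure ?R"
      unfolding closure_sequential
      using tendsto_scaleR[OF q(2) a(2)] by (intro exI[of _ "\<lambda>n. q n *\<^sub>R a n"]) auto
  qed
  have "u i = comb [(1, i)]" for i by (simp add: comb_def)
  then have "range u \<subseteq> ?R" by blast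
  then have u: "range u \<subseteq> closure ?R" using closure_subset by blast
  have "range (comb \<circ> from_nat) = ?R"
    by (metis image_comp surj_from_nat)
  with sub u that[of "comb \<circ> from_nat"] show thesis by simp
qed

lemma diagonal_subseq_convergent:
  fixes a :: "nat \<Rightarrow> nat \<Rightarrow> real"
  assumes bdd: "\<And>k. bounded (range (a k))"
  obtains r where "strict_mono r" "\<And>k. convergent (\<lambda>n. a k (r n))"
proof -
  interpret subseqs "\<lambda>k s. convergent (\<lambda>n. a k (s n))"
  proof
    fix k and s :: "nat \<Rightarrow> nat"
    have "bounded (range (a k \<circ> s))"
      by (rule bounded_subset[OF bdd[of k]]) auto
    then obtain l r where "strict_mono r" "((a k \<circ> s) \<circ> r) \<longlonglongrightarrow> l"
      using bounded_imp_convergent_subsequence by blast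
    then show "\<exists>r. strict_mono r \<and> convergent (\<lambda>n. a k ((s \<circ> r) n))"
      by (auto simp: convergent_def o_def)
  qed
  have "convergent (\<lambda>n. a k ((diagseq \<circ> (+) (Suc k)) n))" for k
  proof (rule diagseq_holds)
    fix r s :: "nat \<Rightarrow> nat" and m
    assume "strict_mono r" "convergent (\<lambda>n. a m (s n))"
    then show "convergent (\<lambda>n. a m ((s \<circ> r) n))"
      using convergent_subseq_convergent[of "\<lambda>n. a m (s n)" r] by (simp add: o_def)
  qed
  then have "convergent (\<lambda>n. a k (diagseq (n + Suc k)))" for k
    by (simp add: o_def add.commute[of _ k])
  then have "convergent (\<lambda>n. a k (diagseq n))" for k
    using convergent_ignore_initial_segment[of "\<lambda>n. a k (diagseq n)" "Suc k"] by blast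
  then show thesis
    using that subseq_diagseq by blast
qed

text \<open>Let \<open>Y\<close> be the closed span of \<open>u\<close>. It is separable, so countably many functionals \<open>g k\<close>, norming for a
dense sequence of \<open>Y\<close>, separate the points of \<open>Y\<close>. A diagonal argument gives a subsequence \<open>v\<close> along
which every \<open>g k\<close> converges. All limit points that \<open>reflexive_limit_point\<close> produces for \<open>v\<close> or
for its subsequences lie in \<open>Y\<close> and have the same values under the \<open>g k\<close>, so they coincide. If
some \<open>f (v n)\<close> did not converge to \<open>f x\<close>, a subsequence of \<open>v\<close> would have a limit point other
than \<open>x\<close>.\<close>

theorem reflexive_bounded_imp_weakly_convergent_subseq:
  fixes u :: "nat \<Rightarrow> 'a::real_normed_vector"
  assumes refl: "reflexive_space TYPE('a)" and bdd: "bounded (range u)"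
  obtains x r where "strict_mono r" "limitin weak_topology (u \<circ> r) x sequentially"
proof -
  obtain D :: "nat \<Rightarrow> 'a" where D: "subspace (closure (range D))" "range u \<subseteq> closure (range D)"
    by (rule countable_dense_closed_subspace)
  let ?Y = "closure (range D)"
  have "\<forall>k. \<exists>f :: 'a \<Rightarrow>\<^sub>L real. (\<forall>x. blinfun_apply f x \<le> norm x) \<and> blinfun_apply f (D k) = norm (D k)"
    using ex_norming_functional by blast
  then obtain g :: "nat \<Rightarrow> 'a \<Rightarrow>\<^sub>L real"
    where g: "\<And>k x. blinfun_apply (g k) x \<le> norm x" "\<And>k. blinfun_apply (g k) (D k) = norm (D k)"
    by metis
  have image_bdd: "bounded (range (\<lambda>n. blinfun_apply f (v n)))"
    if "bounded (range v)" for f :: "'a \<Rightarrow>\<^sub>L real" and v :: "nat \<Rightarrow> 'a"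
    using bounded_linear_image[OF that blinfun.bounded_linear_right[of f]] by (simp add: image_image)
  obtain r where r: "strict_mono r" "\<And>k. convergent (\<lambda>n. blinfun_apply (g k) (u (r n)))"
    using diagonal_subseq_convergent[of "\<lambda>k n. blinfun_apply (g k) (u n)"] image_bdd[OF bdd] by blast
  define v where "v = u \<circ> r"
  have v: "bounded (range v)" "range v \<subseteq> ?Y"
    using bdd D(2) bounded_subset[OF bdd, of "range v"] by (auto simp: v_def)
  have limit_in_Y: "x \<in> ?Y"
    if w: "range w \<subseteq> ?Y"
      and x: "\<And>(f :: 'a \<Rightarrow>\<^sub>L real) l. (\<lambda>n. blinfun_apply f (w n)) \<longlonglongrightarrow> l \<Longrightarrow> blinfun_apply f x = l"
    for w :: "nat \<Rightarrow> 'a" and x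
  proof (rule ccontr)
    assume "x \<notin> ?Y"
    then obtain f :: "'a \<Rightarrow>\<^sub>L real" where f: "\<And>y. y \<in> ?Y \<Longrightarrow> blinfun_apply f y = 0" "blinfun_apply f x \<noteq> 0"
      using ex_annihilating_functional[OF D(1) closed_closure] by blast
    then have "(\<lambda>n. blinfun_apply f (w n)) = (\<lambda>n. 0)"
      using w by (auto simp: fun_eq_iff)
    then show False
      using x[of f 0] f(2) by simp
  qed
  have separating: "z = 0" if z: "z \<in> ?Y" "\<And>k. blinfun_apply (g k) z = 0" for z
  proof -
    have "norm z \<le> e" if "0 < e" for e
    proof -
      have "0 < e / 2" using that by simp
      with z(1) obtain k where k: "dist (D k) z < e / 2"
        unfolding closure_approachable by blast
      have "norm (D k) = blinfun_apply (g k) (D k - z)"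
        using g(2) z(2) by (simp add: blinfun.diff_right)
      also have "\<dots> \<le> norm (D k - z)" by (rule g(1))
      finally have "norm (D k) < e / 2" using k by (simp add: dist_norm)
      then show ?thesis
        using k norm_triangle_ineq[of "D k" "z - D k"] by (simp add: dist_norm norm_minus_commute)
    qed
    then show ?thesis by (metis field_le_epsilon add_0 norm_le_zero_iff)
  qed
  obtain x where x:
    "\<And>(f :: 'a \<Rightarrow>\<^sub>L real) l. (\<lambda>n. blinfun_apply f (v n)) \<longlonglongrightarrow> l \<Longrightarrow> blinfun_apply f x = l"
    using reflexive_limit_point[OF refl v(1)] by blast
  have "(\<lambda>n. blinfun_apply f (v n)) \<longlonglongrightarrow> blinfun_apply f x" for f :: "'a \<Rightarrow>\<^sub>L real"
  proof (rule ccontr)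
    assume "\<not> ?thesis"
    then obtain e where e: "0 < e" "\<exists>\<^sub>F n in sequentially. e \<le> dist (blinfun_apply f (v n)) (blinfun_apply f x)"
      by (auto simp: tendsto_iff not_eventually not_less)
    then have "infinite {n. e \<le> dist (blinfun_apply f (v n)) (blinfun_apply f x)}"
      by (simp add: INFM_iff_infinite[symmetric] frequently_cofinite[symmetric] cofinite_eq_sequentially)
    then obtain s :: "nat \<Rightarrow> nat" where s: "strict_mono s" "\<And>n. e \<le> dist (blinfun_apply f (v (s n))) (blinfun_apply f x)"
      by (metis infinite_enumerate mem_Collect_eq)
    have "bounded (range (v \<circ> s))"
      by (rule bounded_subset[OF v(1)]) auto
    then obtain c t where t: "strict_mono t" "(\<lambda>n. blinfun_apply f ((v \<circ> s) (t n))) \<longlonglongrightarrow> c"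
      using bounded_imp_convergent_subsequence[OF image_bdd, of "v \<circ> s" f] by (auto simp: o_def)
    define w where "w = v \<circ> (s \<circ> t)"
    have w: "bounded (range w)" "range w \<subseteq> ?Y"
      using v bounded_subset[OF v(1), of "range w"] by (auto simp: w_def)
    obtain y where y:
      "\<And>(f :: 'a \<Rightarrow>\<^sub>L real) l. (\<lambda>n. blinfun_apply f (w n)) \<longlonglongrightarrow> l \<Longrightarrow> blinfun_apply f y = l"
      using reflexive_limit_point[OF refl w(1)] by blast
    have "blinfun_apply (g k) (y - x) = 0" for k
    proof -
      obtain l where l: "(\<lambda>n. blinfun_apply (g k) (v n)) \<longlonglongrightarrow> l"
        using r(2)[of k] by (auto simp: convergent_def v_def)
      then have "(\<lambda>n. blinfun_apply (g k) (w n)) \<longlonglongrightarrow> l"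
        using LIMSEQ_subseq_LIMSEQ[OF l strict_mono_o[OF s(1) t(1)]] by (simp add: w_def o_def)
      then show ?thesis
        using x[OF l] y by (simp add: blinfun.diff_right)
    qed
    then have "y = x"
      using separating[of "y - x"] subspace_diff[OF D(1) limit_in_Y[OF w(2) y] limit_in_Y[OF v(2) x]]
      by simp
    then have "(\<lambda>n. blinfun_apply f (w n)) \<longlonglongrightarrow> blinfun_apply f x"
      using t(2) y[of f c] by (simp add: w_def o_def)
    then have "\<forall>\<^sub>F n in sequentially. dist (blinfun_apply f (w n)) (blinfun_apply f x) < e"
      using e(1) by (rule tendstoD)
    then show False
      using s(2) by (auto simp: w_def not_le[symmetric])
  qed
  then have "limitin weak_topology (u \<circ> r) x sequentially"
    by (simp add: limitin_weak_topology_iff v_def)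
  with r(1) that show thesis by blast
qed

section \<open>Weak lower semicontinuity and critical points\<close>

lemma seq_weakly_lsc_iff:
  "seq_weakly_lsc f \<longleftrightarrow>
    (\<forall>u x c. limitin weak_topology u x sequentially \<longrightarrow> c < f x \<longrightarrow>
      (\<forall>\<^sub>F n in sequentially. c < f (u n)))" (is "_ \<longleftrightarrow> ?R")
proof
  assume f: "seq_weakly_lsc f"
  show ?R
  proof (intro allI impI)
    fix u x c
    assume "limitin weak_topology u x sequentially" "c < f x"
    with f have "ereal c < liminf (\<lambda>n. ereal (f (u n)))"
      unfolding seq_weakly_lsc_def by (meson ereal_less_eq(3) less_ereal.simps(1) order_less_le_trans)
    then show "\<forall>\<^sub>F n in sequentially. c < f (u n)"
      by (auto dest: less_LiminfD)
  qed
next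
  assume R: ?R
  show "seq_weakly_lsc f"
    unfolding seq_weakly_lsc_def le_Liminf_iff
  proof (intro allI impI)
    fix u x and y :: ereal
    assume "limitin weak_topology u x sequentially" "y < ereal (f x)"
    with R show "\<forall>\<^sub>F n in sequentially. y < ereal (f (u n))"
      by (cases y) auto
  qed
qed

lemma seq_weakly_lsc_add_scale:
  assumes f: "seq_weakly_lsc f" and g: "seq_weakly_lsc g" and m: "0 \<le> m"
  shows "seq_weakly_lsc (\<lambda>x. f x + m * g x)"
proof (cases "m = 0")
  case False
  with m have m: "0 < m" by simp
  show ?thesis
    unfolding seq_weakly_lsc_iff
  proof (intro allI impI)
    fix u x c
    assume lim: "limitin weak_topology u x sequentially" and c: "c < f x + m * g x"
    define e where "e = (f x + m * g x - c) / 2"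
    have e: "0 < e" using c by (simp add: e_def)
    have "\<forall>\<^sub>F n in sequentially. f x - e < f (u n)"
      using f lim e unfolding seq_weakly_lsc_iff by auto
    moreover have "\<forall>\<^sub>F n in sequentially. g x - e / m < g (u n)"
      using g lim e m unfolding seq_weakly_lsc_iff by auto
    ultimately show "\<forall>\<^sub>F n in sequentially. c < f (u n) + m * g (u n)"
    proof eventually_elim
      case (elim n)
      have "m * (g x - e / m) < m * g (u n)"
        using m elim by simp
      then have "m * g x - e < m * g (u n)"
        using m by (simp add: right_diff_distrib)
      moreover have "2 * e = f x + m * g x - c" by (simp add: e_def)
      ultimately show ?case using elim by linarith
    qed
  qed
qed (use f in simp)

theorem seq_weakly_lsc_attains_min:
  fixes f :: "'a::real_normed_vector \<Rightarrow> real"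
  assumes refl: "reflexive_space TYPE('a)" and f: "seq_weakly_lsc f"
    and C: "closedin weak_topology C" "bounded C" "C \<noteq> {}"
  obtains x where "x \<in> C" "\<And>y. y \<in> C \<Longrightarrow> f x \<le> f y"
proof -
  let ?I = "INF x\<in>C. ereal (f x)"
  obtain a where a: "\<And>n. a n \<in> (\<lambda>x. ereal (f x)) ` C" "a \<longlonglongrightarrow> ?I"
    using Inf_as_limit[of "(\<lambda>x. ereal (f x)) ` C"] C(3) by (metis image_is_empty)
  then have "\<exists>x. x \<in> C \<and> a n = ereal (f x)" for n
    by blast
  then obtain v where v: "\<And>n. v n \<in> C" "\<And>n. a n = ereal (f (v n))"
    by metis
  have "bounded (range v)"
    using v(1) by (intro bounded_subset[OF C(2)]) auto
  then obtain x r where r: "strict_mono r" "limitin weak_topology (v \<circ> r) x sequentially"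
    using reflexive_bounded_imp_weakly_convergent_subseq[OF refl] by blast
  have "x \<in> C"
    by (rule limitin_closedin[OF r(2) C(1)]) (use v(1) in auto)
  moreover have "ereal (f x) \<le> ?I"
  proof -
    have "ereal (f x) \<le> liminf (\<lambda>n. ereal (f ((v \<circ> r) n)))"
      using f r(2) unfolding seq_weakly_lsc_def by blast
    also have "\<dots> = ?I"
      using LIMSEQ_subseq_LIMSEQ[OF a(2) r(1)]
      by (intro lim_imp_Liminf) (auto simp: o_def v(2))
    finally show ?thesis .
  qed
  then have "f x \<le> f y" if "y \<in> C" for y
    using that by (auto simp: le_INF_iff)
  ultimately show thesis by (rule that)
qed

lemma has_gateaux_derivative_add_scale:
  assumes "has_gateaux_derivative f D x" "has_gateaux_derivative g E x"
  shows "has_gateaux_derivative (\<lambda>y. f y + m * g y) (D + m *\<^sub>R E) x"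
  unfolding has_gateaux_derivative_def
proof
  fix h
  have eq: "(f y + m * g y - (f x + m * g x)) / t = (f y - f x) / t + m * ((g y - g x) / t)" for y t
    by (simp add: right_diff_distrib add_divide_distrib diff_divide_distrib)
  have "((\<lambda>t. (f (x + t *\<^sub>R h) - f x) / t + m * ((g (x + t *\<^sub>R h) - g x) / t))
      \<longlongrightarrow> blinfun_apply D h + m * blinfun_apply E h) (at 0)"
    using assms unfolding has_gateaux_derivative_def by (intro tendsto_intros) auto
  then show "((\<lambda>t. (f (x + t *\<^sub>R h) + m * g (x + t *\<^sub>R h) - (f x + m * g x)) / t)
      \<longlongrightarrow> blinfun_apply (D + m *\<^sub>R E) h) (at 0)"
    unfolding eq by (simp add: blinfun.add_left blinfun.scaleR_left)
qed

lemma gateaux_differentiable_add_scale: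
  "gateaux_differentiable f \<Longrightarrow> gateaux_differentiable g \<Longrightarrow>
    gateaux_differentiable (\<lambda>x. f x + m * g x)"
  unfolding gateaux_differentiable_def by (intro allI) (fast intro: has_gateaux_derivative_add_scale)

text \<open>Restricted to any line through \<open>x\<close>, the function has a local minimum at \<open>x\<close>, so each directional
derivative vanishes.\<close>

lemma open_minimizer_imp_critical_point:
  fixes f :: "'a::real_normed_vector \<Rightarrow> real"
  assumes f: "gateaux_differentiable f" and S: "open S" "x \<in> S"
    and min: "\<And>y. y \<in> S \<Longrightarrow> f x \<le> f y"
  shows "critical_point f x"
proof -
  obtain D where D: "has_gateaux_derivative f D x"
    using f unfolding gateaux_differentiable_def by blast
  have "blinfun_apply D h = blinfun_apply 0 h" for h
  proof -
    let ?g = "\<lambda>t. f (x + t *\<^sub>R h)"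
    have deriv: "DERIV ?g 0 :> blinfun_apply D h"
      using D unfolding has_gateaux_derivative_def DERIV_def by simp
    have "open ((\<lambda>t. x + t *\<^sub>R h) -` S)"
      by (intro open_vimage S continuous_intros)
    then obtain d where d: "0 < d" "ball 0 d \<subseteq> (\<lambda>t. x + t *\<^sub>R h) -` S"
      using S(2) by (force simp: open_contains_ball)
    have "\<forall>t. \<bar>0 - t\<bar> < d \<longrightarrow> ?g 0 \<le> ?g t"
      using d(2) min by (auto simp: subset_iff dist_real_def)
    then show ?thesis
      using DERIV_local_min[OF deriv d(1)] by simp
  qed
  then have "D = 0" by (rule blinfun_eqI)
  with D show ?thesis by (simp add: critical_point_def)
qed

lemma global_minimum_iff: "global_minimum f x \<longleftrightarrow> (\<forall>y. f x \<le> f y)"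
proof
  assume "global_minimum f x"
  then have "ereal (f x) \<le> ereal (f y)" for y
    unfolding global_minimum_def global_inf_def by (metis INF_lower UNIV_I)
  then show "\<forall>y. f x \<le> f y" by simp
next
  assume "\<forall>y. f x \<le> f y"
  then show "global_minimum f x"
    unfolding global_minimum_def global_inf_def by (intro antisym INF_lower INF_greatest) auto
qed

lemma ex_inj_subseq:
  fixes u :: "nat \<Rightarrow> 'a"
  assumes "infinite (range u)"
  obtains s :: "nat \<Rightarrow> nat" where "strict_mono s" "inj (u \<circ> s)"
proof -
  \<comment> \<open>the indices at which a value occurs for the first time\<close>
  let ?A = "{n. \<forall>k<n. u k \<noteq> u n}"
  have "range u \<subseteq> u ` ?A"
  proof
    fix y
    assume "y \<in> range u"
    then obtain n where "u n = y" by auto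
    define l where "l = (LEAST n. u n = y)"
    have "u l = y"
      unfolding l_def using \<open>u n = y\<close> by (rule LeastI[of "\<lambda>k. u k = y"])
    moreover have "u k \<noteq> y" if "k < l" for k
      using that unfolding l_def by (rule not_less_Least)
    ultimately have "l \<in> ?A" "y = u l" by auto
    then show "y \<in> u ` ?A" by (rule rev_image_eqI)
  qed
  then have "finite ?A \<Longrightarrow> finite (range u)"
    by (rule finite_surj[rotated])
  with assms have "infinite ?A" by blast
  then obtain s :: "nat \<Rightarrow> nat" where s: "strict_mono s" "\<And>n. s n \<in> ?A"
    using infinite_enumerate[of ?A] by blast
  have "inj (u \<circ> s)"
  proof (rule linorder_injI)
    fix m n :: nat
    assume "m < n"
    then have "s m < s n" by (rule strict_monoD[OF s(1)])
    with s(2)[of n] show "(u \<circ> s) m \<noteq> (u \<circ> s) n" by simp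
  qed
  with s(1) show thesis by (rule that)
qed

section \<open>Minimisers on sublevel sets\<close>

locale coercive_pair =
  fixes \<Phi> \<Psi> :: "'a::real_normed_vector \<Rightarrow> real"
  assumes refl: "reflexive_space TYPE('a)"
    and lsc: "seq_weakly_lsc \<Phi>" "seq_weakly_lsc \<Psi>"
    and diff: "gateaux_differentiable \<Phi>" "gateaux_differentiable \<Psi>"
    and cont: "continuous_on UNIV \<Psi>"
    and coercive: "filterlim \<Psi> at_top at_infinity"
begin

definition sublevel_min :: "real \<Rightarrow> real \<Rightarrow> 'a \<Rightarrow> bool" where
  "sublevel_min \<mu> \<rho> x \<longleftrightarrow>
    \<Psi> x < \<rho> \<and> (\<forall>y. \<Psi> y < \<rho> \<longrightarrow> \<Phi> x + \<mu> * \<Psi> x \<le> \<Phi> y + \<mu> * \<Psi> y)"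

lemma bounded_sublevel: "bounded (\<Psi> -` {..<\<rho>})"
proof -
  have "\<forall>\<^sub>F x in at_infinity. \<rho> \<le> \<Psi> x"
    using coercive by (simp add: filterlim_at_top)
  then obtain b where "\<And>x. b \<le> norm x \<Longrightarrow> \<rho> \<le> \<Psi> x"
    unfolding eventually_at_infinity by blast
  then have "norm x \<le> b" if "x \<in> \<Psi> -` {..<\<rho>}" for x
    using that by (metis linorder_not_less nle_le vimageD lessThan_iff)
  then show ?thesis unfolding bounded_iff by blast
qed

lemma open_sublevel: "open (\<Psi> -` {..<\<rho>})"
  by (intro open_vimage cont open_lessThan)

lemma closure_sublevel_attains_min:
  assumes "seq_weakly_lsc f" "\<Psi> a < \<rho>"
  obtains x where "x \<in> weak_topology closure_of (\<Psi> -` {..<\<rho>})"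
    "\<And>y. y \<in> weak_topology closure_of (\<Psi> -` {..<\<rho>}) \<Longrightarrow> f x \<le> f y"
proof (rule seq_weakly_lsc_attains_min[OF refl assms(1) closedin_closure_of])
  show "bounded (weak_topology closure_of (\<Psi> -` {..<\<rho>}))"
    by (intro bounded_weak_closure bounded_sublevel)
  show "weak_topology closure_of (\<Psi> -` {..<\<rho>}) \<noteq> {}"
    using assms(2) closure_of_subset[of "\<Psi> -` {..<\<rho>}" weak_topology] by auto
qed (rule that)

lemma sublevel_subset_closure: "\<Psi> -` {..<\<rho>} \<subseteq> weak_topology closure_of (\<Psi> -` {..<\<rho>})"
  by (rule closure_of_subset) simp

text \<open>The key step. The hypothesis yields a point \<open>a\<close> of the sublevel set at which
\<open>\<Phi> + \<mu>\<Psi>\<close> is below \<open>min \<Phi> + \<mu>\<rho>\<close>, the minimum being over the weak closure. Any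
point of the closure with \<open>\<Psi> \<ge> \<rho>\<close> has a value of at least \<open>min \<Phi> + \<mu>\<rho>\<close> because
\<open>\<mu> > 0\<close>, so it cannot be a minimiser over the closure.\<close>

lemma ex_sublevel_min:
  assumes "phi \<Phi> \<Psi> \<rho> < ereal \<mu>"
  shows "0 < \<mu>" "\<exists>x. sublevel_min \<mu> \<rho> x"
proof -
  let ?S = "\<Psi> -` {..<\<rho>}"
  let ?C = "weak_topology closure_of ?S"
  obtain a where a: "\<Psi> a < \<rho>"
    "(ereal (\<Phi> a) - (INF y\<in>?C. ereal (\<Phi> y))) / ereal (\<rho> - \<Psi> a) < ereal \<mu>"
    using assms unfolding phi_def INF_less_iff by auto
  obtain z where z: "z \<in> ?C" "\<And>y. y \<in> ?C \<Longrightarrow> \<Phi> z \<le> \<Phi> y"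
    using closure_sublevel_attains_min[OF lsc(1) a(1)] by blast
  \<comment> \<open>the extended-real quotient becomes a real one because the infimum is attained\<close>
  have "(INF y\<in>?C. ereal (\<Phi> y)) = ereal (\<Phi> z)"
    using z by (intro antisym INF_lower INF_greatest) auto
  with a have "(\<Phi> a - \<Phi> z) / (\<rho> - \<Psi> a) < \<mu>" by simp
  with a(1) have a_less: "\<Phi> a - \<Phi> z < \<mu> * (\<rho> - \<Psi> a)"
    by (simp add: pos_divide_less_eq)
  have "\<Phi> z \<le> \<Phi> a"
    using z(2) a(1) sublevel_subset_closure[of \<rho>] by auto
  with a_less have "0 < \<mu> * (\<rho> - \<Psi> a)" by linarith
  with a(1) show mu: "0 < \<mu>" by (simp add: zero_less_mult_iff)
  obtain x where x: "x \<in> ?C" "\<And>y. y \<in> ?C \<Longrightarrow> \<Phi> x + \<mu> * \<Psi> x \<le> \<Phi> y + \<mu> * \<Psi> y"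
    using closure_sublevel_attains_min[OF seq_weakly_lsc_add_scale[OF lsc, of \<mu>] a(1)] mu by auto
  have "\<Phi> x + \<mu> * \<Psi> x \<le> \<Phi> a + \<mu> * \<Psi> a"
    using x(2) a(1) sublevel_subset_closure[of \<rho>] by auto
  also have "\<dots> < \<Phi> z + \<mu> * \<rho>"
    using a_less by (simp add: right_diff_distrib)
  also have "\<dots> \<le> \<Phi> x + \<mu> * \<rho>"
    using z(2)[OF x(1)] by simp
  finally have "\<Psi> x < \<rho>"
    using mu by simp
  then show "\<exists>x. sublevel_min \<mu> \<rho> x"
    using x(2) sublevel_subset_closure[of \<rho>] unfolding sublevel_min_def by blast
qed

lemma sublevel_min_imp_critical_point:
  assumes "sublevel_min \<mu> \<rho> x"
  shows "critical_point (\<lambda>y. \<Phi> y + \<mu> * \<Psi> y) x"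
proof (rule open_minimizer_imp_critical_point)
  show "gateaux_differentiable (\<lambda>y. \<Phi> y + \<mu> * \<Psi> y)"
    by (rule gateaux_differentiable_add_scale[OF diff])
  show "open (\<Psi> -` {..<\<rho>})" by (rule open_sublevel)
qed (use assms in \<open>auto simp: sublevel_min_def\<close>)

text \<open>The sublevel set contains \<open>0\<close>, so a point outside it cannot have a smaller value than the minimum
over its weak closure.\<close>

lemma ex_global_minimum: "\<exists>z. \<forall>y. \<Psi> z \<le> \<Psi> y"
proof -
  let ?S = "\<Psi> -` {..<\<Psi> 0 + 1}"
  obtain z where z: "\<And>y. y \<in> weak_topology closure_of ?S \<Longrightarrow> \<Psi> z \<le> \<Psi> y"
    using closure_sublevel_attains_min[OF lsc(2), of 0 "\<Psi> 0 + 1"] by auto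
  then have S: "\<Psi> z \<le> \<Psi> y" if "\<Psi> y < \<Psi> 0 + 1" for y
    using that sublevel_subset_closure[of "\<Psi> 0 + 1"] by auto
  have "\<Psi> z \<le> \<Psi> y" for y
    using S[of y] S[of 0] by linarith
  then show ?thesis by blast
qed

section \<open>Levels tending to infinity and to the infimum\<close>

text \<open>Every \<open>y\<close> lies in the sublevel set of \<open>\<rho> n\<close> for large \<open>n\<close>, so the minimisers \<open>u n\<close> eventually do at
least as well as \<open>y\<close>; by lower semicontinuity so does their weak limit.\<close>

lemma bounded_critical_points_imp_global_minimum:
  assumes gamma: "gamma_inf \<Phi> \<Psi> < ereal \<mu>"
    and bdd: "bounded {x. critical_point (\<lambda>y. \<Phi> y + \<mu> * \<Psi> y) x}"
  shows "\<exists>x. global_minimum (\<lambda>y. \<Phi> y + \<mu> * \<Psi> y) x"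
proof -
  let ?f = "\<lambda>y. \<Phi> y + \<mu> * \<Psi> y"
  have "\<not> (\<forall>\<^sub>F \<rho> in at_top. ereal \<mu> \<le> phi \<Phi> \<Psi> \<rho>)"
    using gamma Liminf_bounded[of "ereal \<mu>" "phi \<Phi> \<Psi>" at_top] unfolding gamma_inf_def by auto
  then have "\<exists>\<rho>\<ge>b. phi \<Phi> \<Psi> \<rho> < ereal \<mu>" for b
    unfolding eventually_at_top_linorder by (metis linorder_not_less)
  then have "\<exists>\<rho>\<ge>real n. phi \<Phi> \<Psi> \<rho> < ereal \<mu>" for n
    by blast
  then obtain \<rho> where \<rho>: "\<And>n. real n \<le> \<rho> n" "\<And>n. phi \<Phi> \<Psi> (\<rho> n) < ereal \<mu>"
    by metis
  obtain u where u: "\<And>n. sublevel_min \<mu> (\<rho> n) (u n)"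
    using ex_sublevel_min(2)[OF \<rho>(2)] by metis
  have "bounded (range u)"
    using sublevel_min_imp_critical_point[OF u] by (intro bounded_subset[OF bdd]) auto
  then obtain z r where r: "strict_mono r" and z: "limitin weak_topology (u \<circ> r) z sequentially"
    using reflexive_bounded_imp_weakly_convergent_subseq[OF refl] by blast
  have "?f z \<le> ?f y" for y
  proof (rule ccontr)
    assume "\<not> ?f z \<le> ?f y"
    moreover have "seq_weakly_lsc ?f"
      using ex_sublevel_min(1)[OF \<rho>(2)] by (intro seq_weakly_lsc_add_scale lsc) simp
    ultimately have "\<forall>\<^sub>F n in sequentially. ?f y < ?f ((u \<circ> r) n)"
      using z unfolding seq_weakly_lsc_iff by (meson not_le)
    moreover have "\<forall>\<^sub>F n in sequentially. \<Psi> y < real n"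
      using filterlim_real_sequentially unfolding filterlim_at_top_dense by blast
    ultimately have "\<forall>\<^sub>F n in sequentially. False"
    proof eventually_elim
      case (elim n)
      have "real n \<le> \<rho> (r n)"
        using \<rho>(1)[of "r n"] seq_suble[OF r, of n] by linarith
      with elim(2) have "\<Psi> y < \<rho> (r n)" by simp
      with u[of "r n"] have "?f (u (r n)) \<le> ?f y"
        by (simp add: sublevel_min_def)
      with elim(1) show ?case by simp
    qed
    then show False by simp
  qed
  then show ?thesis
    by (auto simp: global_minimum_iff)
qed

text \<open>The minimisers \<open>u n\<close> belong to sublevel sets shrinking to the set of minima of \<open>\<Psi>\<close>. The two
alternatives correspond to whether \<open>u\<close> takes finitely or infinitely many values.\<close>

lemma delta_alternative:
  assumes delta: "delta_inf \<Phi> \<Psi> < ereal \<mu>"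
  shows "(\<exists>x. global_minimum \<Psi> x \<and> local_minimum (\<lambda>y. \<Phi> y + \<mu> * \<Psi> y) x)
    \<or> (\<exists>(u :: nat \<Rightarrow> 'a) x. inj u \<and> (\<forall>n. critical_point (\<lambda>y. \<Phi> y + \<mu> * \<Psi> y) (u n))
        \<and> global_minimum \<Psi> x \<and> limitin weak_topology u x sequentially)"
proof -
  obtain z0 where z0: "\<And>y. \<Psi> z0 \<le> \<Psi> y"
    using ex_global_minimum by blast
  define m where "m = \<Psi> z0"
  have m: "global_inf \<Psi> = ereal m" and m_le: "\<And>y. m \<le> \<Psi> y"
    using z0 global_minimum_iff[of \<Psi> z0] by (auto simp: global_minimum_def m_def)
  have near: "\<exists>\<rho>. m < \<rho> \<and> \<rho> < m + e \<and> phi \<Phi> \<Psi> \<rho> < ereal \<mu>" if "0 < e" for e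
  proof (rule ccontr)
    assume no: "\<not> ?thesis"
    have "\<forall>\<^sub>F r in at_right (ereal m). r < ereal (m + e)"
      using \<open>0 < e\<close> by (intro eventually_at_rightI[of _ "ereal (m + e)"]) auto
    moreover have "\<forall>\<^sub>F r in at_right (ereal m). ereal m < r"
      by (simp add: eventually_at_filter)
    ultimately have "\<forall>\<^sub>F r in at_right (ereal m). ereal m < r \<and> r < ereal (m + e)"
      by eventually_elim simp
    then have "\<forall>\<^sub>F \<rho> in filtercomap ereal (at_right (ereal m)). ereal \<mu> \<le> phi \<Phi> \<Psi> \<rho>"
      unfolding eventually_filtercomap using no
      by (intro exI[of _ "\<lambda>r. ereal m < r \<and> r < ereal (m + e)"]) (auto simp: not_less[symmetric])
    then have "ereal \<mu> \<le> delta_inf \<Phi> \<Psi>"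
      unfolding delta_inf_def m by (rule Liminf_bounded)
    with delta show False by simp
  qed
  have "\<exists>\<rho>. m < \<rho> \<and> \<rho> < m + 1 / real (Suc n) \<and> phi \<Phi> \<Psi> \<rho> < ereal \<mu>" for n
    by (rule near) simp
  then obtain \<rho> where \<rho>: "\<And>n. m < \<rho> n" "\<And>n. \<rho> n < m + 1 / real (Suc n)"
      "\<And>n. phi \<Phi> \<Psi> (\<rho> n) < ereal \<mu>"
    by metis
  obtain u where u: "\<And>n. sublevel_min \<mu> (\<rho> n) (u n)"
    using ex_sublevel_min(2)[OF \<rho>(3)] by metis
  have near_min: "\<forall>\<^sub>F n in sequentially. \<Psi> (u n) < c" if "m < c" for c
  proof -
    have "(\<lambda>n. m + 1 / real (Suc n)) \<longlonglongrightarrow> m + 0"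
      using LIMSEQ_inverse_real_of_nat by (intro tendsto_intros) (simp add: inverse_eq_divide)
    then have "\<forall>\<^sub>F n in sequentially. m + 1 / real (Suc n) < c"
      using that by (intro order_tendstoD) auto
    then show ?thesis
    proof eventually_elim
      case (elim n)
      with \<rho>(2)[of n] u[of n] show ?case by (simp add: sublevel_min_def)
    qed
  qed
  show ?thesis
  proof (cases "finite (range u)")
    case True
    \<comment> \<open>a value taken infinitely often lies in every sublevel set above the minimum\<close>
    then obtain k where k: "infinite {n. u n = u k}"
      using pigeonhole_infinite[of UNIV u] by auto
    have "\<Psi> (u k) \<le> m"
    proof (rule ccontr)
      assume "\<not> ?thesis"
      then have "\<forall>\<^sub>F n in sequentially. \<Psi> (u n) < \<Psi> (u k)"
        by (intro near_min) simp
      then obtain N where "\<And>n. N \<le> n \<Longrightarrow> \<Psi> (u n) < \<Psi> (u k)"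
        unfolding eventually_sequentially by blast
      moreover obtain n where "N \<le> n" "u n = u k"
        using k unfolding infinite_nat_iff_unbounded_le by blast
      ultimately show False by force
    qed
    then have "global_minimum \<Psi> (u k)"
      using m_le unfolding global_minimum_iff by (meson order_trans)
    moreover have "local_minimum (\<lambda>y. \<Phi> y + \<mu> * \<Psi> y) (u k)"
      using u[of k] open_sublevel[of "\<rho> k"] unfolding local_minimum_def eventually_nhds sublevel_min_def
      by (intro exI[of _ "\<Psi> -` {..<\<rho> k}"]) auto
    ultimately show ?thesis by blast
  next
    case False
    \<comment> \<open>an increasing index sequence keeps the levels tending to the minimum\<close>
    then obtain s :: "nat \<Rightarrow> nat" where s: "strict_mono s" "inj (u \<circ> s)"
      by (rule ex_inj_subseq)
    have "\<rho> n < m + 1" for n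
    proof -
      have "1 / real (Suc n) \<le> 1" by simp
      with \<rho>(2)[of n] show ?thesis by linarith
    qed
    then have "range (u \<circ> s) \<subseteq> \<Psi> -` {..<m + 1}"
      using u unfolding sublevel_min_def by (auto intro: less_trans)
    then have "bounded (range (u \<circ> s))"
      by (rule bounded_subset[OF bounded_sublevel])
    from reflexive_bounded_imp_weakly_convergent_subseq[OF refl this]
    obtain z r where r: "strict_mono r"
      and z: "limitin weak_topology (u \<circ> s \<circ> r) z sequentially"
      by blast
    have "\<Psi> z \<le> m"
    proof (rule ccontr)
      assume "\<not> ?thesis"
      then obtain c where c: "m < c" "c < \<Psi> z"
        using dense[of m "\<Psi> z"] by auto
      have "\<forall>\<^sub>F n in sequentially. c < \<Psi> ((u \<circ> s \<circ> r) n)"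
        using lsc(2) z c(2) unfolding seq_weakly_lsc_iff by blast
      moreover have "\<forall>\<^sub>F n in sequentially. \<Psi> ((u \<circ> s \<circ> r) n) < c"
        using eventually_subseq[OF strict_mono_o[OF s(1) r] near_min[OF c(1)]] by simp
      ultimately have "\<forall>\<^sub>F n in sequentially. False"
        by eventually_elim simp
      then show False by simp
    qed
    then have "global_minimum \<Psi> z"
      using m_le unfolding global_minimum_iff by (meson order_trans)
    moreover have "inj (u \<circ> s \<circ> r)"
      using s(2) strict_mono_imp_inj_on[OF r] by (rule inj_compose)
    moreover have "critical_point (\<lambda>y. \<Phi> y + \<mu> * \<Psi> y) ((u \<circ> s \<circ> r) n)" for n
      using sublevel_min_imp_critical_point[OF u] by simp
    ultimately show ?thesis
      using z by blast
  qed
qed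

end

theorem theorem2p5:
  fixes \<Phi> \<Psi> :: "'a::banach \<Rightarrow> real"
  assumes "reflexive_space TYPE('a)"
    and "seq_weakly_lsc \<Phi>" and "gateaux_differentiable \<Phi>"
    and "seq_weakly_lsc \<Psi>" and "gateaux_differentiable \<Psi>"
    and "continuous_on UNIV \<Psi>"
    and "filterlim \<Psi> at_top at_infinity"
  shows "(\<forall>\<rho> \<mu> :: real. global_inf \<Psi> < ereal \<rho> \<longrightarrow> phi \<Phi> \<Psi> \<rho> < ereal \<mu> \<longrightarrow>
            (\<exists>x \<in> \<Psi> -` {..<\<rho>}. critical_point (\<lambda>y. \<Phi> y + \<mu> * \<Psi> y) x))
       \<and> (gamma_inf \<Phi> \<Psi> < \<infinity> \<longrightarrow>
            (\<forall>\<mu> :: real. gamma_inf \<Phi> \<Psi> < ereal \<mu> \<longrightarrow>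
               (\<exists>x. global_minimum (\<lambda>y. \<Phi> y + \<mu> * \<Psi> y) x)
               \<or> \<not> bounded {x. critical_point (\<lambda>y. \<Phi> y + \<mu> * \<Psi> y) x}))
       \<and> (delta_inf \<Phi> \<Psi> < \<infinity> \<longrightarrow>
            (\<forall>\<mu> :: real. delta_inf \<Phi> \<Psi> < ereal \<mu> \<longrightarrow>
               (\<exists>x. global_minimum \<Psi> x \<and> local_minimum (\<lambda>y. \<Phi> y + \<mu> * \<Psi> y) x)
               \<or> (\<exists>(u :: nat \<Rightarrow> 'a) x. inj u
                    \<and> (\<forall>n. critical_point (\<lambda>y. \<Phi> y + \<mu> * \<Psi> y) (u n))
                    \<and> global_minimum \<Psi> x
                    \<and> limitin weak_topology u x sequentially)))"
proof -
  interpret coercive_pair \<Phi> \<Psi>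
    by unfold_locales (use assms in auto)
  have "\<exists>x \<in> \<Psi> -` {..<\<rho>}. critical_point (\<lambda>y. \<Phi> y + \<mu> * \<Psi> y) x"
    if "phi \<Phi> \<Psi> \<rho> < ereal \<mu>" for \<rho> \<mu>
    using ex_sublevel_min(2)[OF that] sublevel_min_imp_critical_point
    by (auto simp: sublevel_min_def)
  then show ?thesis
    using bounded_critical_points_imp_global_minimum delta_alternative by blast
qed

end
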